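(* Let $(X,d)$ be a metric space with at least four points and let $A,B,C\in X$ be three fixed points. Put $a=d(B,C)$, $b=d(C,A)$, $c=d(A,B)$, and for $M\in X$ put $d_1=d(M,A)$, $d_2=d(M,B)$, $d_3=d(M,C)$, $\alpha_1(M)=4d_2^2d_3^2-\big(d_1^2-(d_2^2+d_3^2)\big)^2$ and $\beta_3(M)=d_1^2+d_2^2-d_3^2$. Then a point $M\in X$ fulfills $d_1+d_2-d_3\leq 0$ if and only if $\alpha_1(M)\leq 0$ and $\beta_3(M)\leq 0$. Moreover, if $(X,d)$ is a Ptolemaic metric space, then the set of points $M\in X$ fulfilling $d_1+d_2-d_3\leq 0$ is non-empty if and only if $a\geq c$ or $b\geq c$.
   Context: A metric space $(X,d)$ is called a Ptolemaic metric space if $d(x_1,x_2)\,d(x_3,x_4)\leq d(x_2,x_4)\,d(x_1,x_3)+d(x_1,x_4)\,d(x_2,x_3)$ for every $x_1,x_2,x_3,x_4\in X$. *)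

theory Defs
  imports "HOL-Analysis.Analysis"
begin

locale Ptolemaic_metric_space = Metric_space +
  assumes ptolemy_inequality:
    "\<lbrakk>x1 \<in> M; x2 \<in> M; x3 \<in> M; x4 \<in> M\<rbrakk>
      \<Longrightarrow> d x1 x2 * d x3 x4 \<le> d x2 x4 * d x1 x3 + d x1 x4 * d x2 x3"

definition alpha1 :: "('a \<Rightarrow> 'a \<Rightarrow> real) \<Rightarrow> 'a \<Rightarrow> 'a \<Rightarrow> 'a \<Rightarrow> 'a \<Rightarrow> real" where
  "alpha1 d A B C P =
    (let d1 = d P A; d2 = d P B; d3 = d P C
     in 4 * d2\<^sup>2 * d3\<^sup>2 - (d1\<^sup>2 - (d2\<^sup>2 + d3\<^sup>2))\<^sup>2)"

definition beta3 :: "('a \<Rightarrow> 'a \<Rightarrow> real) \<Rightarrow> 'a \<Rightarrow> 'a \<Rightarrow> 'a \<Rightarrow> 'a \<Rightarrow> real" where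
  "beta3 d A B C P =
    (let d1 = d P A; d2 = d P B; d3 = d P C
     in d1\<^sup>2 + d2\<^sup>2 - d3\<^sup>2)"

end

theory Submission imports Defs begin

text \<open>
  By Heron's factorisation, \<open>\<alpha>\<^sub>1 = (d\<^sub>1 + d\<^sub>2 + d\<^sub>3) (d\<^sub>2 + d\<^sub>3 - d\<^sub>1) (d\<^sub>1 - d\<^sub>2 + d\<^sub>3) (d\<^sub>1 + d\<^sub>2 - d\<^sub>3)\<close>,
  so \<open>\<alpha>\<^sub>1 \<le> 0\<close> says that some triangle inequality among the three distances degenerates or
  fails. The condition \<open>\<beta>\<^sub>3 \<le> 0\<close> makes \<open>d\<^sub>3\<close> the largest of the three, and hence selects the last
  factor as the one responsible. This equivalence is a fact about three nonnegative reals.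

  For the second part, \<open>B\<close> itself lies in the set if \<open>a \<ge> c\<close>, and \<open>A\<close> does if \<open>b \<ge> c\<close>.
  Conversely, Ptolemy's inequality for \<open>P, A, B, C\<close> gives \<open>d\<^sub>3 c \<le> d\<^sub>1 a + d\<^sub>2 b\<close>.
  The right side is at most \<open>(d\<^sub>1 + d\<^sub>2) max a b \<le> d\<^sub>3 max a b\<close>, which forces \<open>max a b \<ge> c\<close>
  unless \<open>d\<^sub>3 = 0\<close>; in that case all four points coincide and \<open>a = c\<close>.
\<close>

lemma heron_factorisation:
  fixes x y z :: real
  shows "4 * y\<^sup>2 * z\<^sup>2 - (x\<^sup>2 - (y\<^sup>2 + z\<^sup>2))\<^sup>2
    = (x + y + z) * (y + z - x) * (x - y + z) * (x + y - z)"
  by (simp add: power2_eq_square algebra_simps)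

text \<open>
  If \<open>x + y > z\<close> although \<open>x\<^sup>2 + y\<^sup>2 \<le> z\<^sup>2\<close>, then neither \<open>x\<close> nor \<open>y\<close> can vanish, because
  \<open>z\<close> dominates both; so all four Heron factors are strictly positive.
\<close>

lemma sum_le_iff_heron_nonpos_and_obtuse:
  fixes x y z :: real
  assumes nonneg: "x \<ge> 0" "y \<ge> 0" "z \<ge> 0"
  shows "x + y \<le> z \<longleftrightarrow>
    4 * y\<^sup>2 * z\<^sup>2 - (x\<^sup>2 - (y\<^sup>2 + z\<^sup>2))\<^sup>2 \<le> 0 \<and> x\<^sup>2 + y\<^sup>2 - z\<^sup>2 \<le> 0"
    (is "?L \<longleftrightarrow> ?alpha \<le> 0 \<and> ?beta \<le> 0")
proof (intro iffI conjI)
  assume le: ?L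
  have "(x + y + z) * (y + z - x) * (x - y + z) \<ge> 0"
    using nonneg le by (intro mult_nonneg_nonneg) auto
  then show "?alpha \<le> 0"
    unfolding heron_factorisation using le by (intro mult_nonneg_nonpos) auto
  have "x\<^sup>2 + y\<^sup>2 \<le> (x + y)\<^sup>2"
    using nonneg by (simp add: power2_sum)
  also have "\<dots> \<le> z\<^sup>2"
    using le nonneg by (intro power_mono) auto
  finally show "?beta \<le> 0" by simp
next
  assume hyp: "?alpha \<le> 0 \<and> ?beta \<le> 0"
  show ?L
  proof (rule ccontr)
    assume gt: "\<not> ?L"
    have "x\<^sup>2 \<le> z\<^sup>2" "y\<^sup>2 \<le> z\<^sup>2"
      using hyp zero_le_power2[of x] zero_le_power2[of y] by linarith+
    then have dominates: "x \<le> z" "y \<le> z"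
      using nonneg by (auto intro: power2_le_imp_le)
    then have "x > 0" "y > 0"
      using gt by linarith+
    then have "(x + y + z) * (y + z - x) * (x - y + z) * (x + y - z) > 0"
      using dominates gt nonneg by (intro mult_pos_pos) linarith+
    then show False
      using hyp unfolding heron_factorisation by linarith
  qed
qed

text \<open>
  Ptolemy's inequality bounds \<open>d P C * d A B\<close> by a combination of the other two sides with
  weights \<open>d P A\<close> and \<open>d P B\<close>, whose total is at most \<open>d P C\<close>; cancelling \<open>d P C\<close> gives the claim.
\<close>

lemma (in Ptolemaic_metric_space) side_le_max_if_dist_sum_le:
  assumes points: "P \<in> M" "A \<in> M" "B \<in> M" "C \<in> M"
    and le: "d P A + d P B \<le> d P C"
  shows "d A B \<le> max (d B C) (d C A)"
proof (cases "d P C = 0")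
  case True
  then have "d P A = 0" "d P B = 0"
    using le nonneg[of P A] nonneg[of P B] by linarith+
  then have "A = B"
    using points by simp
  then show ?thesis
    using points by (simp add: max_def)
next
  case False
  let ?m = "max (d B C) (d C A)"
  have "d P C * d A B \<le> d C B * d P A + d P B * d C A"
    using ptolemy_inequality[of P C A B] points by blast
  also have "\<dots> \<le> ?m * d P A + d P B * ?m"
    by (intro add_mono mult_right_mono mult_left_mono) (auto simp: commute)
  also have "\<dots> = (d P A + d P B) * ?m"
    by (simp add: algebra_simps)
  also have "\<dots> \<le> d P C * ?m"
    using le by (intro mult_right_mono) (auto simp: le_max_iff_disj)
  finally show ?thesis
    using False nonneg[of P C] by (simp add: mult_le_cancel_left)
qed

theorem theorem11:
  fixes X :: "'a set" and d :: "'a \<Rightarrow> 'a \<Rightarrow> real" and A B C :: 'a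
  assumes "Metric_space X d"
    and "\<exists>S \<subseteq> X. card S = 4"
    and "A \<in> X" and "B \<in> X" and "C \<in> X"
  shows "(\<forall>P\<in>X. d P A + d P B - d P C \<le> 0 \<longleftrightarrow>
             alpha1 d A B C P \<le> 0 \<and> beta3 d A B C P \<le> 0)
    \<and> (Ptolemaic_metric_space X d \<longrightarrow>
         (let a = d B C; b = d C A; c = d A B
          in {P \<in> X. d P A + d P B - d P C \<le> 0} \<noteq> {} \<longleftrightarrow> a \<ge> c \<or> b \<ge> c))"
proof -
  interpret Metric_space X d by fact
  have "d P A + d P B - d P C \<le> 0 \<longleftrightarrow> alpha1 d A B C P \<le> 0 \<and> beta3 d A B C P \<le> 0" for P
    using sum_le_iff_heron_nonpos_and_obtuse[of "d P A" "d P B" "d P C"]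
    unfolding alpha1_def beta3_def Let_def by simp
  moreover have "{P \<in> X. d P A + d P B - d P C \<le> 0} \<noteq> {} \<longleftrightarrow> d B C \<ge> d A B \<or> d C A \<ge> d A B"
    if "Ptolemaic_metric_space X d"
  proof
    assume "{P \<in> X. d P A + d P B - d P C \<le> 0} \<noteq> {}"
    then obtain P where "P \<in> X" "d P A + d P B \<le> d P C"
      by auto
    then have "d A B \<le> max (d B C) (d C A)"
      using Ptolemaic_metric_space.side_le_max_if_dist_sum_le[OF that] assms by blast
    then show "d B C \<ge> d A B \<or> d C A \<ge> d A B"
      by (simp add: le_max_iff_disj)
  next
    assume "d B C \<ge> d A B \<or> d C A \<ge> d A B"
    then have "d B A + d B B - d B C \<le> 0 \<or> d A A + d A B - d A C \<le> 0"
      using assms by (simp add: commute)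
    then show "{P \<in> X. d P A + d P B - d P C \<le> 0} \<noteq> {}"
      using assms by blast
  qed
  ultimately show ?thesis
    by (simp add: Let_def)
qed

end
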